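(* Let $\mathcal{A}=\{\alpha_1,\dots,\alpha_{n+k+1}\}\subseteq\mathbb{R}^n$ be a finite set (of $n+k+1$ points) such that $\dim\operatorname{Conv}(\mathcal{A})=n$. The number of sign distributions $\varepsilon\in\{\pm1\}^{n+k+1}$ for which $(\mathcal{A},\varepsilon)$ does not have a non-trivial separating hyperplane is bounded above by $$2\sum_{i=0}^{k-1}\binom{n+k}{i}.$$
   Context: For a sign distribution $\varepsilon\in\{\pm1\}^{n+k+1}$ put $\mathcal{A}_+=\{\alpha_i:\varepsilon_i=1\}$ and $\mathcal{A}_-=\{\alpha_i:\varepsilon_i=-1\}$; the pair $(\mathcal{A},\varepsilon)$ is called a signed support. For $v\in\mathbb{R}^n\setminus\{0\}$, $a\in\mathbb{R}$ let $\mathcal{H}_{v,a}=\{\mu:v\cdot\mu=a\}$, $\mathcal{H}^+_{v,a}=\{\mu:v\cdot\mu\ge a\}$, $\mathcal{H}^-_{v,a}=\{\mu:v\cdot\mu\le a\}$. $\mathcal{H}_{v,a}$ is a separating hyperplane of $(\mathcal{A},\varepsilon)$ if $\mathcal{A}_+\subseteq\mathcal{H}^+_{v,a}$ and $\mathcal{A}_-\subseteq\mathcal{H}^-_{v,a}$; it is non-trivial if at least one of the open half-spaces $\operatorname{int}(\mathcal{H}^+_{v,a})$, $\operatorname{int}(\mathcal{H}^-_{v,a})$ contains a point of $\mathcal{A}$. *)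

theory Defs
  imports "HOL-Analysis.Analysis" "HOL-Library.FuncSet"
begin

text \<open>Points are listed as \<open>\<alpha> 1, \<dots>, \<alpha> N\<close>; only the values of \<open>\<alpha>\<close> on \<open>{1..N}\<close> matter.
  A sign distribution is an extensional function, so that each vector of \<open>{\<plusminus>1}\<^sup>N\<close> is
  represented by exactly one function and cardinalities are the intended ones.\<close>

definition sign_distributions :: "nat \<Rightarrow> (nat \<Rightarrow> int) set" where
  "sign_distributions N = {1..N} \<rightarrow>\<^sub>E {1, -1}"

definition support_pos :: "nat \<Rightarrow> (nat \<Rightarrow> real ^ 'n) \<Rightarrow> (nat \<Rightarrow> int) \<Rightarrow> (real ^ 'n) set" where
  "support_pos N \<alpha> \<epsilon> = {\<alpha> i | i. i \<in> {1..N} \<and> \<epsilon> i = 1}"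

definition support_neg :: "nat \<Rightarrow> (nat \<Rightarrow> real ^ 'n) \<Rightarrow> (nat \<Rightarrow> int) \<Rightarrow> (real ^ 'n) set" where
  "support_neg N \<alpha> \<epsilon> = {\<alpha> i | i. i \<in> {1..N} \<and> \<epsilon> i = -1}"

definition halfspace_pos :: "real ^ 'n \<Rightarrow> real \<Rightarrow> (real ^ 'n) set" where
  "halfspace_pos v a = {\<mu>. v \<bullet> \<mu> \<ge> a}"

definition halfspace_neg :: "real ^ 'n \<Rightarrow> real \<Rightarrow> (real ^ 'n) set" where
  "halfspace_neg v a = {\<mu>. v \<bullet> \<mu> \<le> a}"

text \<open>The hyperplane \<open>{\<mu>. v \<bullet> \<mu> = a}\<close> is given by its parameters \<open>v \<noteq> 0\<close> and \<open>a\<close>, since these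
  also determine which side is the positive one.\<close>

definition separating_hyperplane ::
    "nat \<Rightarrow> (nat \<Rightarrow> real ^ 'n) \<Rightarrow> (nat \<Rightarrow> int) \<Rightarrow> real ^ 'n \<Rightarrow> real \<Rightarrow> bool" where
  "separating_hyperplane N \<alpha> \<epsilon> v a \<longleftrightarrow>
     v \<noteq> 0 \<and> support_pos N \<alpha> \<epsilon> \<subseteq> halfspace_pos v a \<and> support_neg N \<alpha> \<epsilon> \<subseteq> halfspace_neg v a"

definition nontrivial_separating_hyperplane ::
    "nat \<Rightarrow> (nat \<Rightarrow> real ^ 'n) \<Rightarrow> (nat \<Rightarrow> int) \<Rightarrow> real ^ 'n \<Rightarrow> real \<Rightarrow> bool" where
  "nontrivial_separating_hyperplane N \<alpha> \<epsilon> v a \<longleftrightarrow>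
     separating_hyperplane N \<alpha> \<epsilon> v a \<and>
     (interior (halfspace_pos v a) \<inter> \<alpha> ` {1..N} \<noteq> {} \<or>
      interior (halfspace_neg v a) \<inter> \<alpha> ` {1..N} \<noteq> {})"

end

theory Submission
  imports Defs
begin

text \<open>Write \<open>n = CARD('n)\<close> and \<open>N = n + k + 1\<close>, and call a sign distribution inseparable if it
  has no non-trivial separating hyperplane. The bound is an instance of the Sauer--Shelah lemma.

  Any \<open>n\<close> points lie on a common hyperplane \<open>{\<mu>. v \<bullet> \<mu> = a}\<close>, and since \<open>A\<close> spans \<open>\<real>\<^sup>n\<close> affinely,
  this hyperplane misses some point of \<open>A\<close>. A sign distribution that agrees with the sign of
  \<open>v \<bullet> \<alpha> i - a\<close> at the remaining \<open>k + 1\<close> indices is non-trivially separated by it, whatever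
  its values at the \<open>n\<close> indices on the hyperplane. Hence on every set of \<open>k + 1\<close> indices some sign
  pattern is not realised by any inseparable distribution, and reversing \<open>(v, a)\<close> shows that this
  missing pattern may be taken to have a prescribed sign at one of the indices.

  Fix the sign at the index \<open>N\<close>. The inseparable distributions with that sign then form a family of
  subsets of \<open>{1..n + k}\<close> (the positive indices) which shatters no set of \<open>k\<close> elements, so by
  Sauer--Shelah it has at most \<open>\<Sum>i<k. (n + k) choose i\<close> members. The factor \<open>2\<close> accounts for the
  two possible signs at \<open>N\<close>.\<close>

section \<open>Shattered sets\<close>

definition shatters :: "'a set set \<Rightarrow> 'a set \<Rightarrow> bool" where
  "shatters F T \<longleftrightarrow> (\<forall>P \<subseteq> T. \<exists>B \<in> F. B \<inter> T = P)"

lemma shatters_subset: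
  assumes "shatters F T" "T' \<subseteq> T"
  shows "shatters F T'"
  unfolding shatters_def
proof (intro allI impI)
  fix P assume "P \<subseteq> T'"
  then obtain B where "B \<in> F" "B \<inter> T = P"
    using assms subset_trans[OF \<open>P \<subseteq> T'\<close> assms(2)] unfolding shatters_def by blast
  with \<open>P \<subseteq> T'\<close> \<open>T' \<subseteq> T\<close> show "\<exists>B\<in>F. B \<inter> T' = P" by blast
qed

text \<open>Pajor's strengthening of the Sauer--Shelah lemma. Unlike the bound by binomial coefficients
  it is additive: splitting \<open>F\<close> by membership of a point \<open>x\<close> gives two families \<open>F0\<close> and \<open>F1\<close> on
  the remaining points. A set shattered by either is shattered by \<open>F\<close>, and a set \<open>T\<close> shattered by
  both yields the further shattered set \<open>insert x T\<close>.\<close>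
lemma card_le_card_shattered:
  assumes "finite X" "F \<subseteq> Pow X"
  shows "card F \<le> card {T. T \<subseteq> X \<and> shatters F T}"
  using assms
proof (induction X arbitrary: F rule: finite_induct)
  case empty
  then have "F = {} \<or> F = {{}}" by (simp add: subset_singleton_iff)
  then consider "F = {}" | "F = {{}}" by blast
  then show ?case
  proof cases
    case 2
    then have "{T. T \<subseteq> {} \<and> shatters F T} = {{}}" by (auto simp: shatters_def)
    with 2 show ?thesis by simp
  qed simp
next
  case (insert x Y)
  define F0 where "F0 = {B \<in> F. x \<notin> B}"
  define F1 where "F1 = {B. x \<notin> B \<and> insert x B \<in> F}"
  define S where "S G = {T. T \<subseteq> Y \<and> shatters G T}" for G
  have finS: "finite (S G)" for G
    using \<open>finite Y\<close> unfolding S_def by simp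
  have sub: "F0 \<subseteq> Pow Y" "F1 \<subseteq> Pow Y"
    using insert.prems unfolding F0_def F1_def by blast+
  then have finF: "finite F0" "finite F1"
    using \<open>finite Y\<close> by (auto intro: finite_subset[of _ "Pow Y"])
  have F_eq: "F = F0 \<union> insert x ` F1"
  proof
    show "F \<subseteq> F0 \<union> insert x ` F1"
    proof
      fix B assume B: "B \<in> F"
      show "B \<in> F0 \<union> insert x ` F1"
      proof (cases "x \<in> B")
        case True
        with B have "B - {x} \<in> F1" "B = insert x (B - {x})"
          by (auto simp: F1_def insert_absorb)
        then show ?thesis by blast
      qed (use B in \<open>simp add: F0_def\<close>)
    qed
  qed (auto simp: F0_def F1_def)
  have inj: "inj_on (insert x) F1"
    by (rule inj_onI) (simp add: F1_def insert_ident)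
  have "card F = card F0 + card (insert x ` F1)"
    unfolding F_eq by (rule card_Un_disjoint) (use finF in \<open>auto simp: F0_def\<close>)
  also have "\<dots> = card F0 + card F1"
    using inj by (simp add: card_image)
  also have "\<dots> \<le> card (S F0) + card (S F1)"
    unfolding S_def by (intro add_mono insert.IH sub)
  also have "\<dots> = card (S F0 \<union> S F1) + card (S F0 \<inter> S F1)"
    by (rule card_Un_Int) (rule finS)+
  also have "\<dots> = card (S F0 \<union> S F1) + card (insert x ` (S F0 \<inter> S F1))"
  proof -
    have "inj_on (insert x) (S F0 \<inter> S F1)"
    proof (rule inj_onI)
      fix T U assume "T \<in> S F0 \<inter> S F1" "U \<in> S F0 \<inter> S F1" and eq: "insert x T = insert x U"
      then have "x \<notin> T" "x \<notin> U" using \<open>x \<notin> Y\<close> by (auto simp: S_def)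
      with eq show "T = U" by (simp add: insert_ident)
    qed
    then show ?thesis by (simp add: card_image)
  qed
  also have "\<dots> = card (S F0 \<union> S F1 \<union> insert x ` (S F0 \<inter> S F1))"
    by (rule card_Un_disjoint[symmetric]) (use finS \<open>x \<notin> Y\<close> in \<open>auto simp: S_def\<close>)
  also have "\<dots> \<le> card {T. T \<subseteq> insert x Y \<and> shatters F T}"
  proof (rule card_mono)
    show "finite {T. T \<subseteq> insert x Y \<and> shatters F T}"
      using \<open>finite Y\<close> by simp
    have "shatters F T" if "T \<in> S F0" for T
    proof -
      have "F0 \<subseteq> F" by (auto simp: F0_def)
      then show ?thesis using that unfolding S_def shatters_def by blast
    qed
    moreover have "shatters F T" if "T \<in> S F1" for T
    proof -
      have "T \<subseteq> Y" and sh: "shatters F1 T" using that by (auto simp: S_def)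
      then have "x \<notin> T" using \<open>x \<notin> Y\<close> by blast
      show ?thesis
        unfolding shatters_def
      proof (intro allI impI)
        fix P assume "P \<subseteq> T"
        then obtain B where "B \<in> F1" "B \<inter> T = P" using sh unfolding shatters_def by blast
        with \<open>x \<notin> T\<close> have "insert x B \<in> F" "insert x B \<inter> T = P"
          by (auto simp: F1_def)
        then show "\<exists>B\<in>F. B \<inter> T = P" by blast
      qed
    qed
    moreover have "shatters F (insert x T)" if T0: "T \<in> S F0" and T1: "T \<in> S F1" for T
      unfolding shatters_def
    proof (intro allI impI)
      fix P assume P: "P \<subseteq> insert x T"
      show "\<exists>B\<in>F. B \<inter> insert x T = P"
      proof (cases "x \<in> P")
        case True
        have "P - {x} \<subseteq> T" using P by blast
        moreover have "\<forall>P\<subseteq>T. \<exists>B\<in>F1. B \<inter> T = P" using T1 by (simp add: S_def shatters_def)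
        ultimately obtain B where "B \<in> F1" "B \<inter> T = P - {x}" by metis
        then show ?thesis
          using True by (intro bexI[of _ "insert x B"]) (auto simp: F1_def)
      next
        case False
        then have "P \<subseteq> T" using P by blast
        moreover have "\<forall>P\<subseteq>T. \<exists>B\<in>F0. B \<inter> T = P" using T0 by (simp add: S_def shatters_def)
        ultimately obtain B where "B \<in> F0" "B \<inter> T = P" by metis
        then show ?thesis
          by (intro bexI[of _ B]) (auto simp: F0_def)
      qed
    qed
    ultimately show "S F0 \<union> S F1 \<union> insert x ` (S F0 \<inter> S F1)
        \<subseteq> {T. T \<subseteq> insert x Y \<and> shatters F T}"
      by (auto simp: S_def)
  qed
  finally show ?case .
qed

lemma Sauer_Shelah:
  assumes "finite X" "F \<subseteq> Pow X"
    and small: "\<And>T. T \<subseteq> X \<Longrightarrow> card T = k \<Longrightarrow> \<not> shatters F T"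
  shows "card F \<le> (\<Sum>i<k. card X choose i)"
proof -
  have "card T < k" if T: "T \<subseteq> X" "shatters F T" for T
  proof (rule ccontr)
    assume "\<not> card T < k"
    then obtain T' where "T' \<subseteq> T" "card T' = k"
      by (meson not_less obtain_subset_with_card_n)
    then show False
      using small[of T'] shatters_subset[of F T T'] T by auto
  qed
  then have "{T. T \<subseteq> X \<and> shatters F T} \<subseteq> (\<Union>i<k. {T. T \<subseteq> X \<and> card T = i})"
    by blast
  then have "card {T. T \<subseteq> X \<and> shatters F T} \<le> card (\<Union>i<k. {T. T \<subseteq> X \<and> card T = i})"
    by (intro card_mono) (use \<open>finite X\<close> in auto)
  also have "\<dots> \<le> (\<Sum>i<k. card {T. T \<subseteq> X \<and> card T = i})"
    by (rule card_UN_le) simp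
  also have "\<dots> = (\<Sum>i<k. card X choose i)"
    using \<open>finite X\<close> by (simp add: n_subsets)
  finally show ?thesis
    using card_le_card_shattered[OF assms(1,2)] by linarith
qed

section \<open>Hyperplanes and signed supports\<close>

text \<open>The points are lifted to height \<open>-1\<close> in \<open>\<real>\<^sup>n \<times> \<real>\<close>, where at most \<open>n\<close> vectors cannot span; a
  vector \<open>(v, a)\<close> orthogonal to all of them is the required hyperplane. One lifted point is enough
  to force \<open>v \<noteq> 0\<close>.\<close>
lemma hyperplane_through_points:
  fixes C :: "(real ^ 'n) set"
  assumes "finite C" "card C \<le> CARD('n)"
  obtains v a where "v \<noteq> 0" "\<And>x. x \<in> C \<Longrightarrow> v \<bullet> x = a"
proof (cases "C = {}")
  case True
  then show ?thesis using that[of 1 0] by simp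
next
  case False
  then obtain x0 where x0: "x0 \<in> C" by blast
  define L where "L = (\<lambda>x. (x, - 1 :: real)) ` C"
  have "dim L \<le> card L" by (rule dim_le_card') (simp add: L_def assms)
  also have "\<dots> \<le> card C" unfolding L_def by (rule card_image_le[OF assms(1)])
  also have "\<dots> < DIM((real ^ 'n) \<times> real)" using assms(2) by simp
  finally obtain w where w: "w \<noteq> 0" "\<And>y. y \<in> span L \<Longrightarrow> orthogonal w y"
    using orthogonal_to_subspace_exists by blast
  obtain v a where va: "w = (v, a)" by fastforce
  have eq: "v \<bullet> x = a" if "x \<in> C" for x
  proof -
    have "(x, - 1) \<in> span L" using that by (auto simp: L_def intro: span_base)
    then have "orthogonal w (x, - 1)" by (rule w)
    then show ?thesis by (simp add: va orthogonal_def)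
  qed
  have "v \<noteq> 0" using eq[OF x0] w(1) va by (metis inner_zero_left zero_prod_def)
  then show ?thesis using eq that by blast
qed

lemma nontrivial_separating_hyperplaneI:
  fixes \<alpha> :: "nat \<Rightarrow> real ^ 'n"
  assumes "v \<noteq> 0"
    and agree: "\<And>i. i \<in> {1..N} \<Longrightarrow> 0 \<le> of_int (\<epsilon> i) * (v \<bullet> \<alpha> i - a)"
    and j: "j \<in> {1..N}" "v \<bullet> \<alpha> j \<noteq> a"
  shows "nontrivial_separating_hyperplane N \<alpha> \<epsilon> v a"
proof -
  have "support_pos N \<alpha> \<epsilon> \<subseteq> halfspace_pos v a"
    using agree unfolding support_pos_def halfspace_pos_def by fastforce
  moreover have "support_neg N \<alpha> \<epsilon> \<subseteq> halfspace_neg v a"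
    using agree unfolding support_neg_def halfspace_neg_def by fastforce
  moreover have "\<alpha> j \<in> interior (halfspace_pos v a) \<or> \<alpha> j \<in> interior (halfspace_neg v a)"
    using j(2) interior_halfspace_ge[OF \<open>v \<noteq> 0\<close>, of a] interior_halfspace_le[OF \<open>v \<noteq> 0\<close>, of a]
    by (auto simp: halfspace_pos_def halfspace_neg_def)
  ultimately show ?thesis
    using \<open>v \<noteq> 0\<close> j(1)
    unfolding nontrivial_separating_hyperplane_def separating_hyperplane_def by blast
qed

lemma full_dimensional_not_in_hyperplane:
  fixes A :: "(real ^ 'n) set"
  assumes "aff_dim A = int CARD('n)" "v \<noteq> 0"
  obtains x where "x \<in> A" "v \<bullet> x \<noteq> a"
proof -
  have "\<not> A \<subseteq> {x. v \<bullet> x = a}"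
  proof
    assume "A \<subseteq> {x. v \<bullet> x = a}"
    then have "aff_dim A \<le> aff_dim {x. v \<bullet> x = a}" by (rule aff_dim_subset)
    then show False using assms by (simp add: aff_dim_hyperplane)
  qed
  then show ?thesis using that by blast
qed

text \<open>The hyperplane through the \<open>n\<close> points with indices in \<open>{1..n + k} - T\<close> may be oriented
  so that the point with the last index is on the side of the sign \<open>s\<close>. It
  then prescribes signs on \<open>T\<close> that no inseparable distribution with last sign \<open>s\<close> can have.\<close>
lemma inseparable_not_shatters:
  fixes \<alpha> :: "nat \<Rightarrow> real ^ 'n" and k :: nat and s :: int
  defines "N \<equiv> CARD('n) + k + 1"
  assumes full: "aff_dim (\<alpha> ` {1..N}) = int CARD('n)"
    and T: "T \<subseteq> {1..CARD('n) + k}" "card T = k"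
    and insep: "\<And>\<epsilon>. \<epsilon> \<in> E \<Longrightarrow> \<epsilon> \<in> sign_distributions N \<and> \<epsilon> N = s
                  \<and> \<not> (\<exists>v a. nontrivial_separating_hyperplane N \<alpha> \<epsilon> v a)"
  shows "\<not> shatters ((\<lambda>\<epsilon>. {i \<in> {1..CARD('n) + k}. \<epsilon> i = 1}) ` E) T"
proof
  assume sh: "shatters ((\<lambda>\<epsilon>. {i \<in> {1..CARD('n) + k}. \<epsilon> i = 1}) ` E) T"
  let ?C = "{1..CARD('n) + k} - T"
  have "finite T" using T(1) by (rule finite_subset) simp
  then have "card ?C = CARD('n)" using T by (simp add: card_Diff_subset)
  then have "card (\<alpha> ` ?C) \<le> CARD('n)" by (metis card_image_le finite_Diff finite_atLeastAtMost)
  then obtain v0 a0 where v0: "v0 \<noteq> 0" and C0: "\<And>x. x \<in> \<alpha> ` ?C \<Longrightarrow> v0 \<bullet> x = a0"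
    using hyperplane_through_points[of "\<alpha> ` ?C"] by auto
  obtain v a where v: "v \<noteq> 0" and C: "\<And>i. i \<in> ?C \<Longrightarrow> v \<bullet> \<alpha> i = a"
    and last: "0 \<le> of_int s * (v \<bullet> \<alpha> N - a)"
  proof (cases "0 \<le> of_int s * (v0 \<bullet> \<alpha> N - a0)")
    case True
    then show ?thesis using that[of v0 a0] v0 C0 by simp
  next
    case False
    then have "0 \<le> of_int s * ((- v0) \<bullet> \<alpha> N - (- a0))" by (simp add: algebra_simps)
    then show ?thesis using that[of "- v0" "- a0"] v0 C0 by simp
  qed
  have "{i \<in> T. a \<le> v \<bullet> \<alpha> i} \<subseteq> T" by blast
  then obtain \<epsilon> where \<epsilon>: "\<epsilon> \<in> E"
    and trace: "{i \<in> {1..CARD('n) + k}. \<epsilon> i = 1} \<inter> T = {i \<in> T. a \<le> v \<bullet> \<alpha> i}"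
    using sh unfolding shatters_def by blast
  have "0 \<le> of_int (\<epsilon> i) * (v \<bullet> \<alpha> i - a)" if i: "i \<in> {1..N}" for i
  proof -
    have sign: "\<epsilon> i \<in> {1, - 1}"
      using insep[OF \<epsilon>] i unfolding sign_distributions_def by blast
    have "i = N \<or> i \<in> ?C \<or> i \<in> T" using i unfolding N_def by auto
    then consider "i = N" | "i \<in> ?C" | "i \<in> T" by blast
    then show ?thesis
    proof cases
      case 1
      then show ?thesis using last insep[OF \<epsilon>] by simp
    next
      case 2
      then show ?thesis using C by simp
    next
      case 3
      then have "\<epsilon> i = 1 \<longleftrightarrow> a \<le> v \<bullet> \<alpha> i" using trace T(1) by blast
      then show ?thesis using sign by auto
    qed
  qed
  moreover obtain j where "j \<in> {1..N}" "v \<bullet> \<alpha> j \<noteq> a"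
    using full_dimensional_not_in_hyperplane[OF full v, of a] by blast
  ultimately have "nontrivial_separating_hyperplane N \<alpha> \<epsilon> v a"
    using v by (intro nontrivial_separating_hyperplaneI)
  then show False using insep[OF \<epsilon>] by blast
qed

lemma inj_on_positive_indices:
  assumes E: "\<And>\<epsilon>. \<epsilon> \<in> E \<Longrightarrow> \<epsilon> \<in> sign_distributions (Suc m) \<and> \<epsilon> (Suc m) = s"
  shows "inj_on (\<lambda>\<epsilon>. {i \<in> {1..m}. \<epsilon> i = 1}) E"
proof (rule inj_onI)
  fix \<epsilon> \<delta> assume \<epsilon>: "\<epsilon> \<in> E" and \<delta>: "\<delta> \<in> E"
    and eq: "{i \<in> {1..m}. \<epsilon> i = 1} = {i \<in> {1..m}. \<delta> i = 1}"
  have ext: "\<epsilon> \<in> {1..Suc m} \<rightarrow>\<^sub>E {1, - 1}" "\<delta> \<in> {1..Suc m} \<rightarrow>\<^sub>E {1, - 1}"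
    using E \<epsilon> \<delta> unfolding sign_distributions_def by blast+
  then show "\<epsilon> = \<delta>"
  proof (rule PiE_ext)
    fix i assume i: "i \<in> {1..Suc m}"
    show "\<epsilon> i = \<delta> i"
    proof (cases "i = Suc m")
      case True
      then show ?thesis using E[OF \<epsilon>] E[OF \<delta>] by simp
    next
      case False
      then have "i \<in> {1..m}" using i by auto
      then have "\<epsilon> i = 1 \<longleftrightarrow> \<delta> i = 1" using eq by blast
      moreover have "\<epsilon> i \<in> {1, - 1}" "\<delta> i \<in> {1, - 1}" using ext i by blast+
      ultimately show ?thesis by auto
    qed
  qed
qed

theorem proposition3p4:
  fixes A :: "(real ^ 'n) set" and \<alpha> :: "nat \<Rightarrow> real ^ 'n" and k :: nat
  assumes "bij_betw \<alpha> {1..CARD('n) + k + 1} A"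
    and "aff_dim (convex hull A) = int CARD('n)"
  shows "card {\<epsilon> \<in> sign_distributions (CARD('n) + k + 1).
            \<not> (\<exists>v a. nontrivial_separating_hyperplane (CARD('n) + k + 1) \<alpha> \<epsilon> v a)}
         \<le> 2 * (\<Sum>i<k. (CARD('n) + k) choose i)"
proof -
  let ?m = "CARD('n) + k"
  define S where "S = {\<epsilon> \<in> sign_distributions (?m + 1).
            \<not> (\<exists>v a. nontrivial_separating_hyperplane (?m + 1) \<alpha> \<epsilon> v a)}"
  define E where "E s = {\<epsilon> \<in> S. \<epsilon> (?m + 1) = s}" for s
  have full: "aff_dim (\<alpha> ` {1..?m + 1}) = int CARD('n)"
    using assms by (simp add: bij_betw_def aff_dim_convex_hull)
  have bound: "card (E s) \<le> (\<Sum>i<k. ?m choose i)" for s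
  proof -
    let ?pos = "\<lambda>\<epsilon>. {i \<in> {1..?m}. \<epsilon> i = (1 :: int)}"
    have insep: "\<epsilon> \<in> sign_distributions (?m + 1) \<and> \<epsilon> (?m + 1) = s
        \<and> \<not> (\<exists>v a. nontrivial_separating_hyperplane (?m + 1) \<alpha> \<epsilon> v a)" if "\<epsilon> \<in> E s" for \<epsilon>
      using that unfolding E_def S_def by blast
    have "inj_on ?pos (E s)"
      by (rule inj_on_positive_indices[where s = s]) (use insep in auto)
    then have "card (E s) = card (?pos ` E s)" by (simp add: card_image)
    also have "\<dots> \<le> (\<Sum>i<k. card {1..?m} choose i)"
      by (rule Sauer_Shelah) (use inseparable_not_shatters[OF full _ _ insep] in auto)
    finally show ?thesis by simp
  qed
  have "\<epsilon> (?m + 1) \<in> {1, - 1}" if "\<epsilon> \<in> S" for \<epsilon>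
  proof -
    have "\<epsilon> \<in> {1..?m + 1} \<rightarrow>\<^sub>E {1, - 1}"
      using that unfolding S_def sign_distributions_def by blast
    then show ?thesis by (rule PiE_mem) simp
  qed
  then have "S = E 1 \<union> E (- 1)" unfolding E_def by blast
  then have "card S \<le> card (E 1) + card (E (- 1))" by (simp add: card_Un_le)
  also have "\<dots> \<le> 2 * (\<Sum>i<k. ?m choose i)" using bound[of 1] bound[of "- 1"] by linarith
  finally show ?thesis unfolding S_def .
qed

end
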